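(* Let $n\ge 1$ and let $R_1$ be the $(n+1)$-dimensional complex solvable Leibniz algebra with basis $\{f_1,\dots,f_n,x\}$ and multiplication $$[f_i,x]=f_i+f_{i+1}\ (1\le i\le n-1),\qquad [f_n,x]=f_n,$$ all other products of basis elements being zero. Then every $2$-local derivation of $R_1$ is a derivation.
   Context: A (right) Leibniz algebra is a vector space $\mathcal L$ with a bilinear bracket satisfying $[x,[y,z]]=[[x,y],z]-[[x,z],y]$ for all $x,y,z$. A derivation of $\mathcal L$ is a linear map $D:\mathcal L\to\mathcal L$ with $D([x,y])=[D(x),y]+[x,D(y)]$ for all $x,y\in\mathcal L$. A $2$-local derivation of $\mathcal L$ is a map $\nabla:\mathcal L\to\mathcal L$ (not necessarily linear) such that for all $x,y\in\mathcal L$ there is a derivation $D_{x,y}$ of $\mathcal L$ (depending on $x,y$) with $\nabla(x)=D_{x,y}(x)$ and $\nabla(y)=D_{x,y}(y)$. *)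

theory Defs
  imports "HOL-Analysis.Cartesian_Space"
begin

locale leibniz_algebra = vector_space scale
  for scale :: "'k::field \<Rightarrow> 'a::ab_group_add \<Rightarrow> 'a" +
  fixes bracket :: "'a \<Rightarrow> 'a \<Rightarrow> 'a"
  assumes linear_left: "Vector_Spaces.linear scale scale (\<lambda>u. bracket u v)"
    and linear_right: "Vector_Spaces.linear scale scale (\<lambda>v. bracket u v)"
    and leibniz: "bracket u (bracket v w) = bracket (bracket u v) w - bracket (bracket u w) v"
begin

definition derivation :: "('a \<Rightarrow> 'a) \<Rightarrow> bool" where
  "derivation D \<longleftrightarrow> Vector_Spaces.linear scale scale D \<and>
     (\<forall>u v. D (bracket u v) = bracket (D u) v + bracket u (D v))"

definition two_local_derivation :: "('a \<Rightarrow> 'a) \<Rightarrow> bool" where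
  "two_local_derivation \<Delta> \<longleftrightarrow>
     (\<forall>u v. \<exists>D. derivation D \<and> \<Delta> u = D u \<and> \<Delta> v = D v)"

primrec derived_series :: "nat \<Rightarrow> 'a set" where
  "derived_series 0 = UNIV"
| "derived_series (Suc k) =
     span {bracket u v |u v. u \<in> derived_series k \<and> v \<in> derived_series k}"

definition solvable :: bool where
  "solvable \<longleftrightarrow> (\<exists>k. derived_series k = {0})"

end

text \<open>The algebra \<open>R\<^sub>1\<close> is given up to isomorphism: any complex Leibniz algebra with a basis
  \<open>f 1, \<dots>, f n, x\<close> and the stated products. Solvability is a consequence (\<open>solvable\<close> below);
  \<open>R1_algebra_model\<close> shows that the assumptions are satisfiable for every \<open>n\<close>.\<close>

locale R1_algebra = leibniz_algebra scale bracket
  for scale :: "complex \<Rightarrow> 'a::ab_group_add \<Rightarrow> 'a" and bracket :: "'a \<Rightarrow> 'a \<Rightarrow> 'a" +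
  fixes n :: nat and f :: "nat \<Rightarrow> 'a" and x :: 'a
  assumes n_ge_1: "n \<ge> 1"
    and inj_f: "inj_on f {1..n}"
    and x_notin: "x \<notin> f ` {1..n}"
    and basis_independent: "independent (insert x (f ` {1..n}))"
    and basis_span: "span (insert x (f ` {1..n})) = UNIV"
    and bracket_f_x: "\<And>i. 1 \<le> i \<Longrightarrow> i \<le> n - 1 \<Longrightarrow> bracket (f i) x = f i + f (i + 1)"
    and bracket_fn_x: "bracket (f n) x = f n"
    and bracket_f_f: "\<And>i j. i \<in> {1..n} \<Longrightarrow> j \<in> {1..n} \<Longrightarrow> bracket (f i) (f j) = 0"
    and bracket_x_f: "\<And>i. i \<in> {1..n} \<Longrightarrow> bracket x (f i) = 0"
    and bracket_x_x: "bracket x x = 0"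
begin

lemma bracket_in_span:
  assumes u: "u \<in> span B" and v: "v \<in> span C"
    and BC: "\<And>b c. b \<in> B \<Longrightarrow> c \<in> C \<Longrightarrow> bracket b c \<in> span S"
  shows "bracket u v \<in> span S"
proof -
  have l: "module_hom scale scale (\<lambda>u. bracket u v)" for v
    using linear_left[of v] by (simp add: linear_iff_module_hom)
  have r: "module_hom scale scale (\<lambda>v. bracket u v)" for u
    using linear_right[of u] by (simp add: linear_iff_module_hom)
  have 1: "bracket b v \<in> span S" if b: "b \<in> B" for b
  proof (rule span_induct_alt[OF v, where h = "\<lambda>z. bracket b z \<in> span S"])
    show "bracket b 0 \<in> span S" by (simp add: module_hom.zero[OF r] span_zero)
    show "bracket b (scale k c + w) \<in> span S"
      if "c \<in> C" "bracket b w \<in> span S" for k c w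
      using that b by (auto simp: module_hom.add[OF r] module_hom.scale[OF r] intro: span_add span_scale BC)
  qed
  show ?thesis
  proof (rule span_induct_alt[OF u, where h = "\<lambda>z. bracket z v \<in> span S"])
    show "bracket 0 v \<in> span S" by (simp add: module_hom.zero[OF l] span_zero)
    show "bracket (scale k b + w) v \<in> span S"
      if "b \<in> B" "bracket w v \<in> span S" for k b w
      using that by (auto simp: module_hom.add[OF l] module_hom.scale[OF l] intro: span_add span_scale 1)
  qed
qed

lemma solvable: "solvable"
proof -
  have fx: "bracket (f i) x \<in> span (f ` {1..n})" if "i \<in> {1..n}" for i
  proof (cases "i = n")
    case True
    then show ?thesis using that by (auto simp: bracket_fn_x intro: span_base)
  next
    case False
    then have "bracket (f i) x = f i + f (i + 1)" using that by (intro bracket_f_x) auto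
    moreover have "f i + f (i + 1) \<in> span (f ` {1..n})"
      by (rule span_add; rule span_base) (use that False in auto)
    ultimately show ?thesis by simp
  qed
  have 1: "bracket u v \<in> span (f ` {1..n})" for u v
  proof (rule bracket_in_span)
    show "u \<in> span (insert x (f ` {1..n}))" "v \<in> span (insert x (f ` {1..n}))"
      by (simp_all only: basis_span UNIV_I)
  qed (use fx in \<open>auto simp: bracket_f_f bracket_x_f bracket_x_x intro: span_zero\<close>)
  have d1: "derived_series 1 \<subseteq> span (f ` {1..n})"
    unfolding One_nat_def derived_series.simps by (rule span_minimal) (use 1 in auto)
  have "bracket u v \<in> span {}" if "u \<in> derived_series 1" "v \<in> derived_series 1" for u v
    by (rule bracket_in_span[of _ "f ` {1..n}" _ "f ` {1..n}"])
       (use that d1 in \<open>auto simp: bracket_f_f\<close>)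
  then have "derived_series (Suc 1) \<subseteq> span {}"
    unfolding derived_series.simps by (intro span_minimal) auto
  then have "derived_series (Suc 1) = {0}"
    using span_zero by auto
  then show ?thesis unfolding solvable_def by blast
qed

end

lemma R1_algebra_model:
  "\<exists>bracket f x. R1_algebra ((*s) :: complex \<Rightarrow> complex ^ ('n::finite option) \<Rightarrow> _)
     bracket CARD('n) f x"
proof -
  obtain e :: "nat \<Rightarrow> 'n" where e: "bij_betw e {1..CARD('n)} UNIV"
    using ex_bij_betw_nat_finite_1[of "UNIV :: 'n set"] by auto
  define d where "d = inv_into {1..CARD('n)} e"
  have de: "d (e i) = i" if "i \<in> {1..CARD('n)}" for i
    using e that by (simp add: d_def bij_betw_def inv_into_f_f)
  have ed: "e (d k) = k" and dr: "d k \<in> {1..CARD('n)}" for k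
    using e by (auto simp: d_def bij_betw_def f_inv_into_f inv_into_into simp del: atLeastAtMost_iff)
  define T :: "complex ^ 'n option \<Rightarrow> complex ^ 'n option" where
    "T u = (\<chi> j. case j of None \<Rightarrow> 0 | Some k \<Rightarrow>
        u $ Some k + (if d k > 1 then u $ Some (e (d k - 1)) else 0))" for u
  define br where "br u v = (v $ None) *s T u" for u v :: "complex ^ 'n option"
  define f :: "nat \<Rightarrow> complex ^ 'n option" where "f i = axis (Some (e i)) 1" for i
  define x :: "complex ^ 'n option" where "x = axis None 1"
  have T_add: "T (u + v) = T u + T v" for u v
    by (auto simp: vec_eq_iff T_def split: option.split)
  have T_scale: "T (c *s u) = c *s T u" for c u
    by (auto simp: vec_eq_iff T_def algebra_simps split: option.split)
  have T_None: "T u $ None = 0" for u by (simp add: T_def)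
  have basis: "insert x (f ` {1..CARD('n)}) = cart_basis"
  proof -
    have "f ` {1..CARD('n)} = (\<lambda>k. axis (Some k) 1) ` (e ` {1..CARD('n)})"
      by (auto simp: f_def)
    also have "\<dots> = range (\<lambda>k. axis (Some k) 1)"
      using e by (simp add: bij_betw_def)
    finally have "insert x (f ` {1..CARD('n)}) = (\<lambda>j. axis j 1) ` insert None (range Some)"
      by (simp add: x_def image_image)
    also have "\<dots> = cart_basis"
      by (simp only: UNIV_option_conv[symmetric]) (auto simp: cart_basis_def)
    finally show ?thesis .
  qed
  have T_f: "T (f i) = f i + (if i < CARD('n) then f (i + 1) else 0)"
    if i: "i \<in> {1..CARD('n)}" for i
  proof -
    have "T (f i) $ j = (f i + (if i < CARD('n) then f (i + 1) else 0)) $ j" for j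
    proof (cases j)
      case None
      then show ?thesis by (simp add: T_def f_def axis_def)
    next
      case (Some k)
      have a: "k = e m \<longleftrightarrow> d k = m" if "m \<in> {1..CARD('n)}" for m
        using de[OF that] ed[of k] by auto
      have b: "e (d k - 1) = e i \<longleftrightarrow> d k = i + 1" if "d k > 1"
      proof -
        have "d k - 1 \<in> {1..CARD('n)}" using that dr[of k] by auto
        then have "e (d k - 1) = e i \<longleftrightarrow> d k - 1 = i"
          using i e by (intro inj_on_eq_iff[of e]) (auto simp: bij_betw_def)
        then show ?thesis using that by auto
      qed
      have c: "d k \<le> CARD('n)" using dr[of k] by auto
      show ?thesis
        using Some i a[of i] a[of "i + 1"] b c
        by (auto simp: T_def f_def axis_def)
    qed
    then show ?thesis by (simp add: vec_eq_iff)
  qed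
  have "R1_algebra (*s) br CARD('n) f x"
  proof (intro R1_algebra.intro R1_algebra_axioms.intro leibniz_algebra.intro
      leibniz_algebra_axioms.intro)
    show "vector_space ((*s) :: complex \<Rightarrow> complex ^ 'n option \<Rightarrow> _)" ..
    show "Vector_Spaces.linear (*s) (*s) (\<lambda>u. br u v)" for v
      by unfold_locales (auto simp: br_def T_add T_scale vec_eq_iff algebra_simps)
    show "Vector_Spaces.linear (*s) (*s) (\<lambda>v. br u v)" for u
      by unfold_locales (auto simp: br_def vec_eq_iff algebra_simps)
    show "br u (br v w) = br (br u v) w - br (br u w) v" for u v w
      by (simp add: br_def T_None T_scale vec_eq_iff)
    show "inj_on f {1..CARD('n)}"
    proof (rule inj_onI)
      fix i j assume ij: "i \<in> {1..CARD('n)}" "j \<in> {1..CARD('n)}" "f i = f j"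
      then have "e i = e j" by (simp add: f_def axis_eq_axis)
      then have "d (e i) = d (e j)" by (rule arg_cong)
      then show "i = j" by (simp only: de ij)
    qed
    show "x \<notin> f ` {1..CARD('n)}"
      by (auto simp: f_def x_def axis_eq_axis)
    show "vec.independent (insert x (f ` {1..CARD('n)}))"
      unfolding basis by (rule independent_cart_basis)
    show "vec.span (insert x (f ` {1..CARD('n)})) = UNIV"
      unfolding basis by (rule span_cart_basis)
    show "br (f i) x = f i + f (i + 1)" if "1 \<le> i" "i \<le> CARD('n) - 1" for i
      using that T_f[of i] by (auto simp: br_def x_def)
    show "br (f CARD('n)) x = f CARD('n)"
      using T_f[of "CARD('n)"] by (auto simp: br_def x_def)
    show "br u (f j) = 0" for u j
      by (simp add: br_def f_def axis_def)
    show "br x (f j) = 0" for j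
      by (simp add: br_def f_def axis_def)
    have "T x = 0"
      by (auto simp: vec_eq_iff T_def x_def axis_def split: option.split)
    then show "br x x = 0" by (simp add: br_def)
    show "1 \<le> CARD('n)" by simp
  qed
  then show ?thesis by blast
qed

end

theory Submission
  imports Defs
begin

text \<open>A derivation of \<open>R\<^sub>1\<close> is determined by its value at the single vector \<open>f 1\<close>
  (\<open>derivation_determined_by_f1\<close>), and this forces every 2-local derivation \<open>\<Delta>\<close> to be a derivation:
  choose a derivation \<open>D\<^sub>0\<close> with \<open>D\<^sub>0 (f 1) = \<Delta> (f 1)\<close>. For any \<open>u\<close>, a derivation that agrees with
  \<open>\<Delta>\<close> at both \<open>u\<close> and \<open>f 1\<close> agrees with \<open>D\<^sub>0\<close> at \<open>f 1\<close>, hence equals \<open>D\<^sub>0\<close>, so that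
  \<open>\<Delta> u = D\<^sub>0 u\<close>.

  For the determination it suffices that a derivation \<open>D\<close> with \<open>D (f 1) = 0\<close> vanishes. The bracket is
  \<open>[u, v] = \<xi>(v) T u\<close>, where \<open>\<xi>\<close> is the \<open>x\<close>-coordinate and \<open>T\<close> is right multiplication by \<open>x\<close>,
  which is unipotent on the span of the \<open>f i\<close>: \<open>T = 1 + N\<close> with the shift \<open>N (f i) = f (i + 1)\<close>.
  With \<open>c = \<xi>(D x)\<close>, the derivation rule on the \<open>f i\<close> reads \<open>D T - T D = c T\<close>, that is
  \<open>D N - N D = c (1 + N)\<close>, and from \<open>D (f 1) = 0\<close> it propagates along the chain to
  \<open>D (f (k + 1)) = k c T (f k)\<close>. The chain ends at \<open>f n\<close>, as if \<open>f (n + 1)\<close> were zero, and there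
  the rule leaves \<open>n c f n = 0\<close>. In characteristic zero this gives \<open>c = 0\<close>, so \<open>D\<close> kills all
  \<open>f i\<close> and \<open>D x\<close> lies in their span. Finally \<open>[x, x] = 0\<close> gives \<open>T (D x) = 0\<close>, and \<open>D x = 0\<close>
  because \<open>T\<close> is injective on that span.\<close>

context leibniz_algebra
begin

lemma bracket_add_left: "bracket (u + w) v = bracket u v + bracket w v"
  and bracket_scale_left: "bracket (scale a u) v = scale a (bracket u v)"
  and bracket_diff_left: "bracket (u - w) v = bracket u v - bracket w v"
proof -
  have "module_hom scale scale (\<lambda>u. bracket u v)"
    using linear_left[of v] by (simp add: linear_iff_module_hom)
  from module_hom.add[OF this] module_hom.scale[OF this] module_hom.diff[OF this]
  show "bracket (u + w) v = bracket u v + bracket w v"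
    "bracket (scale a u) v = scale a (bracket u v)"
    "bracket (u - w) v = bracket u v - bracket w v" by blast+
qed

lemma bracket_add_right: "bracket u (v + w) = bracket u v + bracket u w"
  and bracket_scale_right: "bracket u (scale a v) = scale a (bracket u v)"
  and bracket_diff_right: "bracket u (v - w) = bracket u v - bracket u w"
proof -
  have "module_hom scale scale (\<lambda>v. bracket u v)"
    using linear_right[of u] by (simp add: linear_iff_module_hom)
  from module_hom.add[OF this] module_hom.scale[OF this] module_hom.diff[OF this]
  show "bracket u (v + w) = bracket u v + bracket u w"
    "bracket u (scale a v) = scale a (bracket u v)"
    "bracket u (v - w) = bracket u v - bracket u w" by blast+
qed

lemma derivation_module_hom: "derivation D \<Longrightarrow> module_hom scale scale D"
  by (simp add: derivation_def linear_iff_module_hom)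

lemma derivation_bracket: "derivation D \<Longrightarrow> D (bracket u v) = bracket (D u) v + bracket u (D v)"
  by (simp add: derivation_def)

lemma derivation_diff:
  assumes "derivation D" "derivation D'"
  shows "derivation (\<lambda>u. D u - D' u)"
proof -
  have "module_hom scale scale (\<lambda>u. D u - D' u)"
    using assms[THEN derivation_module_hom]
    by (simp add: module_hom_iff scale_right_diff_distrib)
  moreover have "D (bracket u v) - D' (bracket u v)
      = bracket (D u - D' u) v + bracket u (D v - D' v)" for u v
    using derivation_bracket[OF assms(1)] derivation_bracket[OF assms(2)]
    by (simp add: bracket_diff_left bracket_diff_right)
  ultimately show ?thesis
    unfolding derivation_def linear_iff_module_hom by (intro conjI allI)
qed

end

context R1_algebra
begin

lemma bracket_span_f_right: "v \<in> span (f ` {1..n}) \<Longrightarrow> bracket u v = 0"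
proof -
  assume v: "v \<in> span (f ` {1..n})"
  have "u \<in> span (insert x (f ` {1..n}))" by (simp only: basis_span UNIV_I)
  then have "bracket u v \<in> span {}"
    using v by (rule bracket_in_span) (use bracket_f_f bracket_x_f in auto)
  then show "bracket u v = 0" by simp
qed

lemma bracket_x_left: "bracket x v = 0"
proof -
  have "x \<in> span {x}" by (simp add: span_base)
  moreover have "v \<in> span (insert x (f ` {1..n}))" by (simp only: basis_span UNIV_I)
  ultimately have "bracket x v \<in> span {}"
    by (rule bracket_in_span) (use bracket_x_x bracket_x_f in auto)
  then show ?thesis by simp
qed

lemma f_nonzero: "i \<in> {1..n} \<Longrightarrow> f i \<noteq> 0"
  using basis_independent dependent_zero by (metis imageI insertI2)

text \<open>Right multiplication by \<open>x\<close> minus the identity is the shift \<open>N\<close>, which moves the filtration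
  by the spans of the tails of the chain one step down.\<close>

lemma shift_span_tail:
  assumes "1 \<le> j" and "w \<in> span (f ` {j..n})"
  shows "bracket w x - w \<in> span (f ` {Suc j..n})"
proof (rule span_induct_alt[OF assms(2), where h = "\<lambda>w. bracket w x - w \<in> span (f ` {Suc j..n})"])
  show "bracket 0 x - 0 \<in> span (f ` {Suc j..n})"
    using bracket_scale_left[of 0 0 x] by (simp add: span_zero)
next
  fix a b w
  assume b: "b \<in> f ` {j..n}" and w: "bracket w x - w \<in> span (f ` {Suc j..n})"
  then obtain i where i: "i \<in> {j..n}" "b = f i" by blast
  have "bracket b x - b \<in> span (f ` {Suc j..n})"
  proof (cases "i = n")
    case True
    then show ?thesis using i by (simp add: bracket_fn_x span_zero)
  next
    case False
    then have "1 \<le> i" "i \<le> n - 1" using i(1) assms(1) by auto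
    then have "bracket b x - b = f (i + 1)"
      by (simp only: i(2) bracket_f_x add_diff_cancel_left')
    then show ?thesis using i False by (auto intro!: span_base)
  qed
  then have "scale a (bracket b x - b) + (bracket w x - w) \<in> span (f ` {Suc j..n})"
    using w by (intro span_add span_scale)
  then show "bracket (scale a b + w) x - (scale a b + w) \<in> span (f ` {Suc j..n})"
    by (simp add: bracket_add_left bracket_scale_left scale_right_diff_distrib algebra_simps)
qed

text \<open>If \<open>T w = 0\<close> then \<open>w = - N w\<close>, so \<open>w\<close> sinks through the whole filtration.\<close>

lemma bracket_x_right_injective:
  assumes "w \<in> span (f ` {1..n})" and "bracket w x = 0"
  shows "w = 0"
proof -
  have "w \<in> span (f ` {Suc j..n})" for j
  proof (induction j)
    case 0
    then show ?case using assms(1) by simp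
  next
    case (Suc j)
    then have "bracket w x - w \<in> span (f ` {Suc (Suc j)..n})"
      by (intro shift_span_tail) simp
    then show ?case using assms(2) span_neg by fastforce
  qed
  from this[of n] show ?thesis by simp
qed

text \<open>Solving the rule \<open>D N - N D = c (1 + N)\<close> along the chain, starting from \<open>D (f 1) = 0\<close>.
  At \<open>k = 0\<close> the vector \<open>f 0\<close> is arbitrary, but its coefficient is zero.\<close>

lemma derivation_chain:
  assumes D: "derivation D" and D1: "D (f 1) = 0"
    and c: "\<And>u. bracket u (D x) = scale c (bracket u x)"
    and "k < n"
  shows "D (f (Suc k)) = scale (of_nat k * c) (bracket (f k) x)"
  using \<open>k < n\<close>
proof (induction k)
  case 0
  then show ?case using D1 by simp
next
  case (Suc k)
  let ?y = "scale (of_nat k * c) (bracket (f k) x)"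
  have IH: "D (f (Suc k)) = ?y" using Suc by simp
  have fk: "bracket (f (Suc k)) x = f (Suc k) + f (Suc (Suc k))"
    using Suc.prems bracket_f_x[of "Suc k"] by simp
  have y: "bracket ?y x = ?y + scale (of_nat k * c) (bracket (f (Suc k)) x)"
  proof (cases "k = 0")
    case True
    then show ?thesis using bracket_scale_left[of 0 0 x] by simp
  next
    case False
    then have "bracket (f k) x = f k + f (Suc k)"
      using Suc.prems bracket_f_x[of k] by simp
    then have "bracket (bracket (f k) x) x = bracket (f k) x + bracket (f (Suc k)) x"
      by (simp add: bracket_add_left)
    then show ?thesis
      by (simp add: bracket_scale_left scale_right_distrib)
  qed
  have "D (f (Suc k)) + D (f (Suc (Suc k))) = D (bracket (f (Suc k)) x)"
    using module_hom.add[OF derivation_module_hom[OF D]] fk by simp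
  also have "\<dots> = bracket (D (f (Suc k))) x + bracket (f (Suc k)) (D x)"
    by (rule derivation_bracket[OF D])
  also have "\<dots> = ?y + scale (of_nat k * c) (bracket (f (Suc k)) x)
      + scale c (bracket (f (Suc k)) x)"
    by (simp only: IH y c)
  also have "\<dots> = ?y + scale (of_nat (Suc k) * c) (bracket (f (Suc k)) x)"
    by (simp add: scale_left_distrib algebra_simps)
  finally show ?case by (simp add: IH)
qed

lemma derivation_eq_0:
  assumes D: "derivation D" and D1: "D (f 1) = 0"
  shows "D u = 0"
proof -
  have hom: "module_hom scale scale D" by (rule derivation_module_hom[OF D])
  obtain m where m: "n = Suc m" using n_ge_1 by (cases n) auto
  have "D x \<in> span (insert x (f ` {1..n}))" by (simp only: basis_span UNIV_I)
  then obtain c where cx: "D x - scale c x \<in> span (f ` {1..n})"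
    using span_breakdown_eq by blast
  have c: "bracket v (D x) = scale c (bracket v x)" for v
    using bracket_span_f_right[OF cx, of v] by (simp add: bracket_diff_right bracket_scale_right)
  note chain = derivation_chain[OF D D1 c]

  \<comment> \<open>The rule at the end of the chain, where \<open>T (f n) = f n\<close>.\<close>
  have "D (f n) = bracket (D (f n)) x + scale c (f n)"
    using derivation_bracket[OF D, of "f n" x] by (simp add: bracket_fn_x c)
  moreover have "bracket (D (f n)) x = D (f n) + scale (of_nat m * c) (f n)"
  proof (cases "m = 0")
    case True
    then show ?thesis using D1 m bracket_scale_left[of 0 0 x] by simp
  next
    case False
    then have "bracket (f m) x = f m + f n"
      using m bracket_f_x[of m] by simp
    then show ?thesis
      using chain[of m] m bracket_fn_x
      by (simp add: bracket_scale_left bracket_add_left scale_right_distrib)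
  qed
  ultimately have "scale (of_nat m * c) (f n) + scale c (f n) = 0"
    by (metis add.assoc add_cancel_right_right)
  then have "scale ((of_nat m + 1) * c) (f n) = 0"
    by (simp add: scale_left_distrib algebra_simps)
  then have "(of_nat m + 1) * c = 0"
    using f_nonzero[of n] n_ge_1 by simp
  moreover have "of_nat m + 1 \<noteq> (0 :: complex)"
    using of_nat_neq_0[of m, where 'a = complex] by (simp add: add.commute)
  ultimately have c0: "c = 0" by simp

  have Df: "D (f i) = 0" if "i \<in> {1..n}" for i
  proof -
    have "i - 1 < n" "Suc (i - 1) = i" using that by auto
    then show ?thesis using chain[of "i - 1"] c0 by (simp only: mult_zero_right scale_zero_left)
  qed
  have "bracket (D x) x = 0"
    using derivation_bracket[OF D, of x x] module_hom.zero[OF hom]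
    by (simp add: bracket_x_x bracket_x_left)
  then have "D x = 0"
    using cx c0 by (intro bracket_x_right_injective[of "D x"]) simp_all
  then have "D b = 0" if "b \<in> insert x (f ` {1..n})" for b
    using that Df by blast
  then show "D u = 0"
    using module_hom.eq_0_on_span[OF hom, of "insert x (f ` {1..n})" u] basis_span by simp
qed

lemma derivation_determined_by_f1:
  assumes "derivation D" "derivation D'" "D (f 1) = D' (f 1)"
  shows "D u = D' u"
  using derivation_eq_0[OF derivation_diff[OF assms(1,2)]] assms(3) by simp

theorem two_local_derivation_is_derivation:
  assumes "two_local_derivation \<Delta>"
  shows "derivation \<Delta>"
proof -
  obtain D\<^sub>0 where D0: "derivation D\<^sub>0" "\<Delta> (f 1) = D\<^sub>0 (f 1)"
    using assms unfolding two_local_derivation_def by blast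
  have "\<Delta> u = D\<^sub>0 u" for u
  proof -
    obtain D where D: "derivation D" "\<Delta> u = D u" "\<Delta> (f 1) = D (f 1)"
      using assms unfolding two_local_derivation_def by blast
    then show ?thesis
      using derivation_determined_by_f1[OF D(1) D0(1)] D0(2) by simp
  qed
  then have "\<Delta> = D\<^sub>0" by blast
  then show ?thesis using D0(1) by simp
qed

end

theorem proposition4p4:
  fixes scale :: "complex \<Rightarrow> 'a::ab_group_add \<Rightarrow> 'a"
    and bracket :: "'a \<Rightarrow> 'a \<Rightarrow> 'a"
    and n :: nat and f :: "nat \<Rightarrow> 'a" and x :: 'a
    and \<Delta> :: "'a \<Rightarrow> 'a"
  assumes "R1_algebra scale bracket n f x"
    and "leibniz_algebra.two_local_derivation scale bracket \<Delta>"
  shows "leibniz_algebra.derivation scale bracket \<Delta>"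
  using assms by (rule R1_algebra.two_local_derivation_is_derivation)

end
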